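(* Let $L>0$ and let $f:[0,1]\to\mathbb{R}$ be $L$-Lipschitz continuous, i.e. $|f(x)-f(y)|\le L|x-y|$ for all $x,y\in[0,1]$. Let $x_1,x_2,\ldots$ be the queries of the binary sampling algorithm run on $f$ with scores $s'=\min(f(x_0),f(x_1))-L\left|\frac{x_1-x_0}{2}\right|$ for the midpoint candidate of an interval with endpoints $x_0<x_1$. Then for every number of evaluations $T\ge 1$ the cumulative regret satisfies $$R_T\le L\log_2(3T).$$
   Context: Binary sampling algorithm on $[0,1]$. The first two queries are the boundary points $0$ and $1$, whose values $f(0),f(1)$ are received. The algorithm maintains a list of candidate points: whenever two already queried points $x_0<x_1$ are adjacent (no query lies strictly between them), the list contains exactly one candidate associated with them, the midpoint $x'=\frac{x_0+x_1}{2}$, with an assigned score $s'$; here $s'=\min(f(x_0),f(x_1))-L\left|\frac{x_1-x_0}{2}\right|$. At every subsequent step the algorithm queries the candidate $x_m$ with the lowest score (ties broken arbitrarily), receives $f(x_m)$, and removes $x_m$ from the list. If $x_m$ was the midpoint of the adjacent queries $x_l<x_r$, it then adds the midpoint candidates, with their scores, of the two new intervals $[x_l,x_m]$ and $[x_m,x_r]$. Denoting by $x_t$ the $t$-th query, the cumulative regret after $T$ queries is $R_T=\sum_{t=1}^T f(x_t)-T\min_{x\in[0,1]}f(x)$. *)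

theory Defs
  imports "HOL-Analysis.Analysis"
begin

definition lipschitz_score :: "real \<Rightarrow> (real \<Rightarrow> real) \<Rightarrow> real \<Rightarrow> real \<Rightarrow> real" where
  "lipschitz_score L f x0 x1 = min (f x0) (f x1) - L * \<bar>(x1 - x0) / 2\<bar>"

text \<open>
  \<open>x t\<close> is the \<open>t\<close>-th query, counted from 1 (\<open>x 0\<close> is irrelevant), and \<open>C t\<close> is the collection
  of candidates after the first \<open>t\<close> queries (relevant for \<open>t \<ge> 2\<close>). A candidate is
  represented by the pair \<open>(l, r)\<close> of adjacent queries it belongs to: the candidate point is
  \<open>(l + r) / 2\<close> and its assigned score is \<open>score l r\<close>. Ties are broken arbitrarily because any
  candidate of lowest score may be chosen.
\<close>

definition binary_sampling_run ::
  "(real \<Rightarrow> real \<Rightarrow> real) \<Rightarrow> (nat \<Rightarrow> real) \<Rightarrow> (nat \<Rightarrow> (real \<times> real) set) \<Rightarrow> bool" where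
  "binary_sampling_run score x C \<longleftrightarrow>
     x 1 = 0 \<and> x 2 = 1 \<and> C 2 = {(0, 1)} \<and>
     (\<forall>t\<ge>2. \<exists>l r. (l, r) \<in> C t \<and>
        (\<forall>(l', r')\<in>C t. score l r \<le> score l' r') \<and>
        x (Suc t) = (l + r) / 2 \<and>
        C (Suc t) = (C t - {(l, r)}) \<union> {(l, x (Suc t)), (x (Suc t), r)})"

definition binary_sampling :: "(real \<Rightarrow> real \<Rightarrow> real) \<Rightarrow> (nat \<Rightarrow> real) \<Rightarrow> bool" where
  "binary_sampling score x \<longleftrightarrow> (\<exists>C. binary_sampling_run score x C)"

text \<open>
  The infimum is an attained minimum for the functions considered here; see
  \<open>lipschitz_INF_attained\<close>.
\<close>

definition cumulative_regret :: "(real \<Rightarrow> real) \<Rightarrow> (nat \<Rightarrow> real) \<Rightarrow> nat \<Rightarrow> real" where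
  "cumulative_regret f x T = (\<Sum>t=1..T. f (x t)) - real T * (INF y\<in>{0..1}. f y)"

lemma lipschitz_INF_attained:
  fixes f :: "real \<Rightarrow> real"
  assumes "L-lipschitz_on {0..1} f"
  shows "\<exists>z\<in>{0..1}. f z = (INF y\<in>{0..1}. f y) \<and> (\<forall>y\<in>{0..1}. f z \<le> f y)"
proof -
  have "continuous_on {0..1} f"
    using assms by (rule lipschitz_on_continuous_on)
  then obtain z where z: "z \<in> {0..1}" "\<forall>y\<in>{0..1}. f z \<le> f y"
    using continuous_attains_inf[of "{0..1::real}" f] by auto
  then have "(INF y\<in>{0..1}. f y) = f z"
    by (intro cInf_eq_minimum) auto
  with z show ?thesis by auto
qed

end

(*
  A queried midpoint of an interval of width w has regret at most L * w: the lowest score is at most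
  min f, because the interval containing a minimiser already has such a score, and f at the midpoint
  exceeds its score by at most L * w. Halving an interval of width w raises the entropy (in bits) of
  the partition of [0, 1] into candidate intervals by exactly w. So, after the two boundary queries,
  which together cost at most L, the regret is at most L times the entropy of a partition into T - 1
  intervals, hence at most L * log 2 (T - 1).
*)

theory Submission
  imports Defs
begin

section \<open>Partitions of the unit interval and their refinement\<close>

definition interval_partition :: "(real \<times> real) set \<Rightarrow> bool" where
  "interval_partition C \<longleftrightarrow>
     finite C \<and>
     (\<forall>(l, r)\<in>C. 0 \<le> l \<and> l < r \<and> r \<le> 1) \<and>
     (\<forall>z\<in>{0..1}. \<exists>(l, r)\<in>C. l \<le> z \<and> z \<le> r) \<and>
     (\<forall>(l, r)\<in>C. \<forall>(l', r')\<in>C. (l, r) \<noteq> (l', r') \<longrightarrow> r \<le> l' \<or> r' \<le> l)"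

definition split_interval ::
    "(real \<times> real) set \<Rightarrow> real \<Rightarrow> real \<Rightarrow> real \<Rightarrow> (real \<times> real) set" where
  "split_interval C l m r = (C - {(l, r)}) \<union> {(l, m), (m, r)}"

definition partition_entropy :: "(real \<times> real) set \<Rightarrow> real" where
  "partition_entropy C = (\<Sum>(l, r)\<in>C. - (r - l) * log 2 (r - l))"

lemma interval_partition_split:
  assumes C: "interval_partition C" and lr: "(l, r) \<in> C" and m: "l < m" "m < r"
  shows "interval_partition (split_interval C l m r)"
proof -
  have bounds: "0 \<le> a \<and> a < b \<and> b \<le> 1" if "(a, b) \<in> C" for a b
    using C that unfolding interval_partition_def by blast
  have cover: "\<exists>(a, b)\<in>C. a \<le> z \<and> z \<le> b" if "z \<in> {0..1}" for z
    using C that unfolding interval_partition_def by blast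
  have sep: "b \<le> c \<or> d \<le> a" if "(a, b) \<in> C" "(c, d) \<in> C" "(a, b) \<noteq> (c, d)" for a b c d
    using C that unfolding interval_partition_def by blast
  have "finite (split_interval C l m r)"
    using C unfolding interval_partition_def split_interval_def by simp
  moreover have "\<forall>(a, b)\<in>split_interval C l m r. 0 \<le> a \<and> a < b \<and> b \<le> 1"
    using bounds[OF lr] m by (auto simp: split_interval_def dest: bounds)
  moreover have "\<exists>(a, b)\<in>split_interval C l m r. a \<le> z \<and> z \<le> b" if "z \<in> {0..1}" for z
  proof -
    obtain a b where ab: "(a, b) \<in> C" "a \<le> z" "z \<le> b"
      using cover[OF \<open>z \<in> {0..1}\<close>] by auto
    show ?thesis
    proof (cases "(a, b) = (l, r)")
      case True
      with ab show ?thesis by (cases "z \<le> m") (auto simp: split_interval_def)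
    next
      case False
      with ab show ?thesis by (auto simp: split_interval_def)
    qed
  qed
  moreover have "b \<le> c \<or> d \<le> a"
    if ab: "(a, b) \<in> split_interval C l m r" and cd: "(c, d) \<in> split_interval C l m r"
      and neq: "(a, b) \<noteq> (c, d)"
    for a b c d
  proof -
    \<comment> \<open>An old interval avoids the whole of \<open>(l, r)\<close>, hence each of its
      two parts; the parts themselves meet only at \<open>m\<close>.\<close>
    have old_new: "b \<le> l \<or> r \<le> a" if "(a, b) \<in> C - {(l, r)}" for a b
      using sep[OF _ lr, of a b] that by auto
    have mem: "p \<in> C - {(l, r)} \<or> p = (l, m) \<or> p = (m, r)" if "p \<in> split_interval C l m r" for p
      using that unfolding split_interval_def by blast
    show ?thesis
    proof (cases "(a, b) \<in> C - {(l, r)} \<and> (c, d) \<in> C - {(l, r)}")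
      case True
      with sep[of a b c d] neq show ?thesis by simp
    next
      case False
      then consider
          "(a, b) \<in> C - {(l, r)}" "(c, d) \<in> {(l, m), (m, r)}"
        | "(a, b) \<in> {(l, m), (m, r)}" "(c, d) \<in> C - {(l, r)}"
        | "(a, b) \<in> {(l, m), (m, r)}" "(c, d) \<in> {(l, m), (m, r)}"
        using mem[OF ab] mem[OF cd] by blast
      then show ?thesis
      proof cases
        case 1
        then show ?thesis using old_new[OF 1(1)] m by auto
      next
        case 2
        then show ?thesis using old_new[OF 2(2)] m by auto
      next
        case 3
        then show ?thesis using neq by auto
      qed
    qed
  qed
  ultimately show ?thesis
    unfolding interval_partition_def by blast
qed

text \<open>One bookkeeping rule for three quantities: \<open>g\<close> constantly 1 tracks the
  number of intervals, \<open>g\<close> the width tracks the total length, and \<open>g\<close> the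
  entropy summand tracks the entropy.\<close>

lemma sum_split_interval:
  fixes g :: "real \<times> real \<Rightarrow> real"
  assumes C: "interval_partition C" and lr: "(l, r) \<in> C" and m: "l < m" "m < r"
  shows "sum g (split_interval C l m r) = sum g C - g (l, r) + g (l, m) + g (m, r)"
proof -
  have fin: "finite C"
    using C by (simp add: interval_partition_def)
  have sep: "b \<le> l \<or> r \<le> a" if "(a, b) \<in> C" "(a, b) \<noteq> (l, r)" for a b
    using C lr that unfolding interval_partition_def by blast
  have "sum g (split_interval C l m r) = sum g (C - {(l, r)}) + sum g {(l, m), (m, r)}"
    \<comment> \<open>Neither part can already belong to \<open>C\<close>, because it would overlap
      \<open>(l, r)\<close>; so the union is disjoint and nothing is lost in the sum.\<close>
    unfolding split_interval_def using fin m sep[of l m] sep[of m r]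
    by (intro sum.union_disjoint) auto
  then show ?thesis
    using fin lr m by (simp add: sum_diff1)
qed

section \<open>Entropy of partitions\<close>

lemma partition_entropy_halve:
  assumes "interval_partition C" "(l, r) \<in> C" "l < r"
  shows "partition_entropy (split_interval C l ((l + r) / 2) r) = partition_entropy C + (r - l)"
proof -
  have m: "l < (l + r) / 2" "(l + r) / 2 < r"
    using assms(3) by auto
  have half: "(l + r) / 2 - l = (r - l) / 2" "r - (l + r) / 2 = (r - l) / 2"
    by (simp_all add: field_simps)
  have "log 2 ((r - l) / 2) = log 2 (r - l) - 1"
    using assms(3) by (simp add: log_divide)
  \<comment> \<open>Both halves have the same width, and their logarithm is smaller by 1. Together
    they still have weight \<open>r - l\<close>, so the gain is \<open>(r - l) * 1\<close>.\<close>
  moreover have "partition_entropy (split_interval C l ((l + r) / 2) r) =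
      partition_entropy C - (- (r - l) * log 2 (r - l))
        + (- ((r - l) / 2) * log 2 ((r - l) / 2)) + (- ((r - l) / 2) * log 2 ((r - l) / 2))"
    unfolding partition_entropy_def
    using sum_split_interval[OF assms(1,2) m, of "\<lambda>(l, r). - (r - l) * log 2 (r - l)"]
    by (simp only: prod.case half)
  ultimately show ?thesis
    by (simp only:) (simp add: field_simps)
qed

text \<open>The uniform distribution maximises entropy. This is Gibbs' inequality against the
  weights \<open>1 / card C\<close>, obtained term by term from ln u \<le> u - 1 at u =
  \<open>1 / (card C * (r - l))\<close>.\<close>

lemma partition_entropy_le_log_card:
  assumes C: "interval_partition C" and width: "(\<Sum>(l, r)\<in>C. r - l) = 1"
  shows "partition_entropy C \<le> log 2 (card C)"
proof -
  have fin: "finite C"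
    using C by (simp add: interval_partition_def)
  have "C \<noteq> {}"
    using width by auto
  with fin have card: "card C > 0"
    by (simp add: card_gt_0_iff)
  \<comment> \<open>The corrections \<open>1 / card C - (r - l)\<close> cancel in the sum: there are
    \<open>card C\<close> of them and the widths add up to 1.\<close>
  have "- (r - l) * ln (r - l) \<le> (r - l) * ln (card C) + (1 / card C - (r - l))"
    if "(l, r) \<in> C" for l r
  proof -
    have pos: "r - l > 0"
      using C that unfolding interval_partition_def by fastforce
    have "ln (1 / (card C * (r - l))) \<le> 1 / (card C * (r - l)) - 1"
      using pos card by (intro ln_le_minus_one) simp
    also have "ln (1 / (card C * (r - l))) = - ln (card C) - ln (r - l)"
      using ln_mult[of "real (card C)" "r - l"] pos card by (simp only: ln_div) simp
    finally have "(r - l) * (- ln (card C) - ln (r - l)) \<le> (r - l) * (1 / (card C * (r - l)) - 1)"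
      using pos by (intro mult_left_mono) auto
    also have "\<dots> = 1 / card C - (r - l)"
      using pos card by (simp add: field_simps)
    finally show ?thesis
      by (simp add: algebra_simps)
  qed
  then have "(\<Sum>(l, r)\<in>C. - (r - l) * ln (r - l))
      \<le> (\<Sum>(l, r)\<in>C. (r - l) * ln (card C) + (1 / card C - (r - l)))"
    by (intro sum_mono) auto
  also have "\<dots> = ln (card C)"
    using width card
    by (simp add: case_prod_unfold sum.distrib sum_subtractf flip: sum_distrib_right)
  finally have "(\<Sum>(l, r)\<in>C. - (r - l) * ln (r - l)) / ln 2 \<le> ln (card C) / ln 2"
    by (intro divide_right_mono) auto
  then show ?thesis
    by (simp add: partition_entropy_def log_def sum_divide_distrib case_prod_unfold)
qed

section \<open>Regret of the sampling run\<close>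

lemma lipschitz_midpoint_regret:
  fixes f :: "real \<Rightarrow> real"
  assumes lip: "L-lipschitz_on {0..1} f" and C: "interval_partition C" and lr: "(l, r) \<in> C"
    and lowest: "\<forall>(l', r')\<in>C. lipschitz_score L f l r \<le> lipschitz_score L f l' r'"
    and z: "z \<in> {0..1}"
  shows "f ((l + r) / 2) - f z \<le> L * (r - l)"
proof -
  have L0: "L \<ge> 0"
    using lip by (rule lipschitz_on_nonneg)
  have bounds: "0 \<le> a \<and> a < b \<and> b \<le> 1" if "(a, b) \<in> C" for a b
    using C that unfolding interval_partition_def by blast
  have lipD: "f u - f v \<le> L * \<bar>u - v\<bar>" if "u \<in> {0..1}" "v \<in> {0..1}" for u v
    using lipschitz_onD[OF lip that] by (simp add: dist_real_def)
  obtain a b where ab: "(a, b) \<in> C" "a \<le> z" "z \<le> b"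
    using C z unfolding interval_partition_def by blast
  have "f a - f z \<le> L * (z - a)" "f b - f z \<le> L * (b - z)"
    using lipD[of a z] lipD[of b z] ab bounds[OF ab(1)] z by auto
  \<comment> \<open>Averaging the two endpoint bounds removes the position of \<open>z\<close>: the
    mean exceeds \<open>f z\<close> by at most \<open>L * (b - a) / 2\<close>, exactly what the
    score subtracts.\<close>
  moreover have "min (f a) (f b) \<le> (f a + f b) / 2"
    by (simp add: min_def)
  ultimately have "lipschitz_score L f a b \<le> f z"
    using bounds[OF ab(1)] by (simp add: lipschitz_score_def field_simps)
  with lowest ab(1) have score: "lipschitz_score L f l r \<le> f z"
    by fastforce
  have half: "\<bar>(l + r) / 2 - l\<bar> = (r - l) / 2" "\<bar>(l + r) / 2 - r\<bar> = (r - l) / 2"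
    using bounds[OF lr] by (auto simp: field_simps abs_if)
  \<comment> \<open>The midpoint is half a width away from either end. The score lies another
    \<open>L * (r - l) / 2\<close> below the minimum, which gives the full
    \<open>L * (r - l)\<close>.\<close>
  have "f ((l + r) / 2) \<le> min (f l) (f r) + L * ((r - l) / 2)"
    using lipD[of "(l + r) / 2" l] lipD[of "(l + r) / 2" r] bounds[OF lr] unfolding half by auto
  with score show ?thesis
    using bounds[OF lr] by (simp add: lipschitz_score_def field_simps)
qed

text \<open>Each new query costs at most \<open>L\<close> times the entropy that its split creates,
  so the sum telescopes. Cardinality and total width are carried along by additivity under
  splitting; they are what the entropy bound asks for.\<close>

lemma binary_sampling_run_regret:
  fixes f :: "real \<Rightarrow> real"
  assumes lip: "L-lipschitz_on {0..1} f"
    and run: "binary_sampling_run (lipschitz_score L f) x C"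
    and z: "z \<in> {0..1}" and t: "t \<ge> 2"
  shows "interval_partition (C t) \<and> real (card (C t)) = real t - 1 \<and>
    (\<Sum>(l, r)\<in>C t. r - l) = 1 \<and>
    (\<Sum>i=1..t. f (x i) - f z) \<le> L * (1 + partition_entropy (C t))"
  using t
proof (induction t rule: dec_induct)
  case base
  have start: "x 1 = 0" "x 2 = 1" "C 2 = {(0, 1)}"
    using run by (auto simp: binary_sampling_run_def)
  \<comment> \<open>The distances from \<open>z\<close> to 0 and 1 add up to 1. This is the summand
    1 in the invariant, since the single interval of width 1 has entropy 0.\<close>
  have "f 0 - f z \<le> L * z" "f 1 - f z \<le> L * (1 - z)"
    using lipschitz_onD[OF lip, of 0 z] lipschitz_onD[OF lip, of 1 z] z
    by (auto simp: dist_real_def)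
  then have "(f 0 - f z) + (f 1 - f z) \<le> L"
    by (simp add: algebra_simps)
  moreover have "(\<Sum>i=1..2. f (x i) - f z) = (f 0 - f z) + (f 1 - f z)"
    using start by (simp add: numeral_2_eq_2)
  ultimately show ?case
    by (simp add: start interval_partition_def partition_entropy_def)
next
  case (step t)
  have "\<exists>l r. (l, r) \<in> C t \<and>
        (\<forall>(l', r')\<in>C t. lipschitz_score L f l r \<le> lipschitz_score L f l' r') \<and>
        x (Suc t) = (l + r) / 2 \<and>
        C (Suc t) = (C t - {(l, r)}) \<union> {(l, x (Suc t)), (x (Suc t), r)}"
    using run \<open>2 \<le> t\<close> by (simp add: binary_sampling_run_def)
  then obtain l r where lr: "(l, r) \<in> C t"
      and lowest: "\<forall>(l', r')\<in>C t. lipschitz_score L f l r \<le> lipschitz_score L f l' r'"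
      and xt: "x (Suc t) = (l + r) / 2"
      and Ct: "C (Suc t) = (C t - {(l, r)}) \<union> {(l, x (Suc t)), (x (Suc t), r)}"
    by (elim exE conjE)
  from step.IH have part: "interval_partition (C t)" and card: "real (card (C t)) = real t - 1"
    and width: "(\<Sum>(l, r)\<in>C t. r - l) = 1"
    and regret: "(\<Sum>i=1..t. f (x i) - f z) \<le> L * (1 + partition_entropy (C t))"
    by auto
  have lt: "l < r"
    using part lr unfolding interval_partition_def by blast
  then have m: "l < (l + r) / 2" "(l + r) / 2 < r"
    by auto
  have split: "C (Suc t) = split_interval (C t) l ((l + r) / 2) r"
    unfolding Ct xt split_interval_def ..
  note sum_split = sum_split_interval[OF part lr m, folded split]
  have "interval_partition (C (Suc t))"
    unfolding split using interval_partition_split[OF part lr m] .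
  moreover have "real (card (C (Suc t))) = real (Suc t) - 1"
    using sum_split[of "\<lambda>_. 1"] card by simp
  moreover have "(\<Sum>(l, r)\<in>C (Suc t). r - l) = 1"
    using sum_split[of "\<lambda>(l, r). r - l"] width by (simp add: field_simps)
  moreover have "(\<Sum>i=1..Suc t. f (x i) - f z) \<le> L * (1 + partition_entropy (C (Suc t)))"
  proof -
    have "f (x (Suc t)) - f z \<le> L * (r - l)"
      unfolding xt using lipschitz_midpoint_regret[OF lip part lr lowest z] .
    with regret have "(\<Sum>i=1..t. f (x i) - f z) + (f (x (Suc t)) - f z)
        \<le> L * (1 + (partition_entropy (C t) + (r - l)))"
      by (simp add: algebra_simps)
    then show ?thesis
      using partition_entropy_halve[OF part lr lt] by (simp add: split)
  qed
  ultimately show ?case by blast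
qed

theorem theorem1:
  fixes L :: real and f :: "real \<Rightarrow> real" and x :: "nat \<Rightarrow> real" and T :: nat
  assumes "L > 0"
    and "L-lipschitz_on {0..1} f"
    and "binary_sampling (lipschitz_score L f) x"
    and "T \<ge> 1"
  shows "cumulative_regret f x T \<le> L * log 2 (3 * real T)"
proof -
  obtain C where run: "binary_sampling_run (lipschitz_score L f) x C"
    using assms(3) by (auto simp: binary_sampling_def)
  obtain z where z: "z \<in> {0..1}" "f z = (INF y\<in>{0..1}. f y)"
    using lipschitz_INF_attained[OF assms(2)] by blast
  have eq: "cumulative_regret f x T = (\<Sum>i=1..T. f (x i) - f z)"
    by (simp add: cumulative_regret_def z(2) sum_subtractf)
  show ?thesis
  proof (cases "T = 1")
    \<comment> \<open>The invariant starts only at two queries. Here the sole query 0 costs at most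
      \<open>L * z\<close>, and \<open>log 2 3\<close> is at least 1.\<close>
    case True
    have "x 1 = 0"
      using run by (simp add: binary_sampling_run_def)
    then have "cumulative_regret f x T = f 0 - f z"
      using eq True by simp
    also have "\<dots> \<le> L * z"
      using lipschitz_onD[OF assms(2), of 0 z] z(1) by (auto simp: dist_real_def)
    also have "\<dots> \<le> L * log 2 (3 * real T)"
    proof (intro mult_left_mono)
      have "z \<le> 1"
        using z(1) by simp
      also have "1 \<le> log 2 (3 * real T)"
        using True by simp
      finally show "z \<le> log 2 (3 * real T)" .
    qed (use assms(1) in simp)
    finally show ?thesis .
  next
    case False
    with assms(4) have T: "T \<ge> 2" by simp
    note inv = binary_sampling_run_regret[OF assms(2) run z(1) T]
    have "partition_entropy (C T) \<le> log 2 (real T - 1)"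
      using inv partition_entropy_le_log_card[of "C T"] by simp
    then have "1 + partition_entropy (C T) \<le> 1 + log 2 (real T - 1)"
      by simp
    \<comment> \<open>The cost of the boundary queries is absorbed as a factor 2 under the
      logarithm; the constant 3 then leaves room to spare.\<close>
    also have "\<dots> = log 2 (2 * (real T - 1))"
      using T by (subst log_mult) auto
    also have "\<dots> \<le> log 2 (3 * real T)"
      using T by simp
    finally have "L * (1 + partition_entropy (C T)) \<le> L * log 2 (3 * real T)"
      using assms(1) by simp
    with inv eq show ?thesis by simp
  qed
qed

end
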